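(* Let $\sigma:\mathbb{R}\to\mathbb{R}$ be a bounded sigmoidal function, i.e. $\sup_{x\in\mathbb{R}}|\sigma(x)|<\infty$, $\lim_{x\to+\infty}\sigma(x)=1$ and $\lim_{x\to-\infty}\sigma(x)=0$. Let $a<b$ be real numbers, let $f:[a,b]\to\mathbb{R}$ be continuous on $[a,b]$, and let $\varepsilon>0$. For a positive integer $N$, define the points $x_k = a+(k-1)\frac{b-a}{N}$ for $k=0,1,\dots,N+1$ (so $x_0=a-\frac{b-a}{N}$, $x_1=a$, $x_{N+1}=b$; this is the uniform partition of $\left[a-\frac{b-a}{N},b\right]$). Then there exist a positive integer $N$ and a real number $w>0$ such that for all $x\in[a,b]$, $$\left|\sum_{k=2}^{N+1}\bigl[f(x_k)-f(x_{k-1})\bigr]\,\sigma\bigl(w(x-x_k)\bigr)+f(a)\,\sigma\bigl(w(x-x_0)\bigr)-f(x)\right|<\varepsilon .$$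
   Context: A function $\sigma:\mathbb{R}\to\mathbb{R}$ is called sigmoidal if $\lim_{x\to-\infty}\sigma(x)=0$ and $\lim_{x\to+\infty}\sigma(x)=1$. It is bounded if there is $M>0$ with $|\sigma(x)|\le M$ for all $x\in\mathbb{R}$. *)

theory Defs
  imports "HOL-Analysis.Analysis"
begin

definition sigmoidal :: "(real \<Rightarrow> real) \<Rightarrow> bool" where
  "sigmoidal \<sigma> \<longleftrightarrow> (\<sigma> \<longlongrightarrow> 0) at_bot \<and> (\<sigma> \<longlongrightarrow> 1) at_top"

(* The subtraction is on the reals, so that k = 0 gives the point a - (b - a) / N
   to the left of the interval. *)
definition grid_point :: "real \<Rightarrow> real \<Rightarrow> nat \<Rightarrow> nat \<Rightarrow> real" where
  "grid_point a b N k = a + (real k - 1) * ((b - a) / real N)"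

end

theory Submission
  imports Defs
begin

text \<open>
  Replace each \<open>\<sigma> (w * (x - x\<^sub>k))\<close> by the step value 1 if \<open>x\<^sub>k \<le> x\<close> and 0 otherwise: the sum
  telescopes and the result is \<open>f x\<^sub>j\<close>, with \<open>x\<^sub>j\<close> the grid point just left of \<open>x\<close>. For \<open>w\<close> large the
  replacement costs at most \<open>\<delta>\<close> per term when \<open>x\<^sub>k\<close> is at least one mesh width away from \<open>x\<close>. This
  fails only for \<open>k = j\<close> and \<open>k = j + 1\<close>, where the boundedness of \<open>\<sigma>\<close> and the smallness of
  \<open>f x\<^sub>k - f x\<^bsub>k-1\<^esub>\<close> are used instead.
\<close>

text \<open>The terms with k \<le> j telescope. The cap \<open>min j (N + 1)\<close> lets the
  induction on \<open>N\<close> run with \<open>j\<close> fixed, also when \<open>j\<close> exceeds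
  the range of summation.\<close>

lemma sum_diff_step:
  fixes F :: "nat \<Rightarrow> real"
  assumes "1 \<le> j"
  shows "(\<Sum>k=2..N+1. (F k - F (k - 1)) * of_bool (k \<le> j)) = F (min j (N + 1)) - F 1"
proof (induction N)
  case 0
  then show ?case using assms by simp
next
  case (Suc N)
  have "(\<Sum>k=2..Suc N+1. (F k - F (k - 1)) * of_bool (k \<le> j)) =
     (\<Sum>k=2..N+1. (F k - F (k - 1)) * of_bool (k \<le> j))
      + (F (N + 2) - F (N + 1)) * of_bool (N + 2 \<le> j)"
    by simp
  also have "\<dots> = F (min j (N + 1)) - F 1 + (F (N + 2) - F (N + 1)) * of_bool (N + 2 \<le> j)"
    using Suc.IH by simp
  also have "\<dots> = F (min j (Suc N + 1)) - F 1"
    by (cases "N + 2 \<le> j") (auto simp: min_def not_le le_Suc_eq)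
  finally show ?case .
qed

text \<open>Dilation by a large \<open>w\<close> pushes every y with |y| \<ge> h into the region
  where \<sigma> is already close to its limit, so one \<open>w\<close> serves all such y.\<close>

lemma sigmoidal_scaled:
  assumes "sigmoidal \<sigma>" "h > 0" "\<delta> > 0"
  obtains w where "w > 0" "\<And>y. y \<ge> h \<Longrightarrow> \<bar>\<sigma> (w * y) - 1\<bar> \<le> \<delta>" "\<And>y. y \<le> -h \<Longrightarrow> \<bar>\<sigma> (w * y)\<bar> \<le> \<delta>"
proof -
  have "eventually (\<lambda>t. dist (\<sigma> t) 0 < \<delta>) at_bot" "eventually (\<lambda>t. dist (\<sigma> t) 1 < \<delta>) at_top"
    using assms unfolding sigmoidal_def tendsto_iff by auto
  then obtain A B where A: "\<And>t. t \<le> A \<Longrightarrow> \<bar>\<sigma> t\<bar> < \<delta>" and B: "\<And>t. t \<ge> B \<Longrightarrow> \<bar>\<sigma> t - 1\<bar> < \<delta>"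
    unfolding eventually_at_bot_linorder eventually_at_top_linorder dist_real_def by auto
  \<comment> \<open>Chosen so that w * h lies above \<open>B\<close> and -(w * h) below
    \<open>A\<close>; the summand 1 keeps \<open>w\<close> positive when A = B = 0.\<close>
  define w where "w = (\<bar>A\<bar> + \<bar>B\<bar> + 1) / h"
  have wh: "w * h = \<bar>A\<bar> + \<bar>B\<bar> + 1" using assms by (simp add: w_def)
  have w: "w > 0" using assms by (simp add: w_def add_nonneg_pos)
  show ?thesis
  proof
    fix y
    show "\<bar>\<sigma> (w * y) - 1\<bar> \<le> \<delta>" if "y \<ge> h"
      using mult_left_mono[OF that less_imp_le[OF w]] wh by (intro less_imp_le B) linarith
    show "\<bar>\<sigma> (w * y)\<bar> \<le> \<delta>" if "y \<le> -h"
      using mult_left_mono[OF that less_imp_le[OF w]] wh by (intro less_imp_le A) simp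
  qed (rule w)
qed

text \<open>The index is one more than the integer part of (x - a) / h, since the numbering puts a
  at index 1. For x = b it is N + 1, and the upper point then lies beyond b.\<close>

lemma grid_point_bracket:
  assumes "a < b" "N > 0" "x \<in> {a..b}"
  obtains j where "1 \<le> j" "j \<le> N + 1" "grid_point a b N j \<le> x" "x < grid_point a b N (j + 1)"
proof -
  define h where "h = (b - a) / N"
  have h: "h > 0" "N * h = b - a" using assms by (auto simp: h_def)
  define m where "m = nat \<lfloor>(x - a) / h\<rfloor>"
  have "(x - a) / h \<ge> 0" using assms h by simp
  then have "real m \<le> (x - a) / h" "(x - a) / h < real m + 1"
    unfolding m_def by linarith+
  then have m: "m * h \<le> x - a" "x - a < (m + 1) * h"
    using h by (simp_all add: field_simps)
  have "m * h \<le> N * h" using m(1) h assms by auto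
  then have "m \<le> N" using h(1) by simp
  then show ?thesis
    using m by (intro that[of "m + 1"]) (auto simp: grid_point_def h_def add.commute)
qed

theorem mainTheorem1:
  fixes \<sigma> f :: "real \<Rightarrow> real" and a b \<epsilon> :: real
  assumes "bounded (range \<sigma>)"
    and "sigmoidal \<sigma>"
    and "a < b"
    and "continuous_on {a..b} f"
    and "\<epsilon> > 0"
  shows "\<exists>(N::nat) (w::real). N > 0 \<and> w > 0 \<and>
    (\<forall>x\<in>{a..b}.
      \<bar>(\<Sum>k=2..N+1. (f (grid_point a b N k) - f (grid_point a b N (k - 1)))
                       * \<sigma> (w * (x - grid_point a b N k)))
        + f a * \<sigma> (w * (x - grid_point a b N 0)) - f x\<bar> < \<epsilon>)"
proof -
  obtain M where M: "\<And>t. \<bar>\<sigma> t\<bar> \<le> M"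
    using assms(1) unfolding bounded_iff by auto
  have M0: "M \<ge> 0" using M[of 0] by linarith
  \<comment> \<open>Error budget in units of \<eta>: 2 * M + 3 for replacing \<sigma> by steps in
    the sum, 1 for the term with \<open>f a\<close>, 1 for passing from \<open>f (g j)\<close> to
    \<open>f x\<close>.\<close>
  define \<eta> where "\<eta> = \<epsilon> / (2 * M + 5)"
  have \<eta>: "\<eta> > 0" "\<eta> * (2 * M + 5) = \<epsilon>" using M0 assms(5) by (auto simp: \<eta>_def)
  have "uniformly_continuous_on {a..b} f"
    using assms(4) by (intro compact_uniformly_continuous) auto
  then obtain d where d: "d > 0"
    "\<And>x y. x \<in> {a..b} \<Longrightarrow> y \<in> {a..b} \<Longrightarrow> \<bar>x - y\<bar> < d \<Longrightarrow> \<bar>f x - f y\<bar> < \<eta>"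
    using \<eta>(1) unfolding uniformly_continuous_on_def dist_real_def by metis
  obtain N :: nat where N: "(b - a) / d < N" using reals_Archimedean2 by blast
  have N0: "N > 0"
    using N assms(3) d(1) by (metis diff_gt_0_iff_gt divide_pos_pos less_trans of_nat_0_less_iff)
  define h where "h = (b - a) / N"
  have h: "h > 0" "h < d" "N * h = b - a"
    using N N0 assms(3) d(1) by (auto simp: h_def field_simps)
  \<comment> \<open>The first bound keeps the total of N errors \<delta> below 1, the second
    controls the term with \<open>f a\<close>; adding 1 there covers f a = 0.\<close>
  define \<delta> where "\<delta> = min (1 / N) (\<eta> / (\<bar>f a\<bar> + 1))"
  have \<delta>0: "\<delta> > 0" using N0 \<eta>(1) by (auto simp: \<delta>_def)
  have "N * \<delta> \<le> N * (1 / N)" by (intro mult_left_mono) (auto simp: \<delta>_def)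
  then have N\<delta>: "N * \<delta> \<le> 1" using N0 by simp
  have "(\<bar>f a\<bar> + 1) * \<delta> \<le> (\<bar>f a\<bar> + 1) * (\<eta> / (\<bar>f a\<bar> + 1))"
    by (intro mult_left_mono) (auto simp: \<delta>_def)
  then have "(\<bar>f a\<bar> + 1) * \<delta> \<le> \<eta>" by (simp add: add_nonneg_eq_0_iff)
  then have fa\<delta>: "\<bar>f a\<bar> * \<delta> \<le> \<eta>" using \<delta>0 by (simp add: distrib_right)
  obtain w where w: "w > 0" "\<And>y. y \<ge> h \<Longrightarrow> \<bar>\<sigma> (w * y) - 1\<bar> \<le> \<delta>" "\<And>y. y \<le> -h \<Longrightarrow> \<bar>\<sigma> (w * y)\<bar> \<le> \<delta>"
    using sigmoidal_scaled[OF assms(2) h(1) \<delta>0] by blast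
  define g where "g = grid_point a b N"
  have g: "g k = a + (real k - 1) * h" for k by (simp add: g_def grid_point_def h_def)
  have gI: "g k \<in> {a..b}" if "1 \<le> k" "k \<le> N + 1" for k
  proof -
    have "0 \<le> (real k - 1) * h" "(real k - 1) * h \<le> N * h"
      using that h(1) by (auto intro!: mult_right_mono mult_nonneg_nonneg)
    then show ?thesis using h(3) by (simp add: g)
  qed
  have g_diff: "g k - g l \<ge> h" if "l < k" for k l
  proof -
    have "1 * h \<le> (real k - real l) * h"
      using that h(1) by (intro mult_right_mono) auto
    then show ?thesis by (simp add: g algebra_simps)
  qed
  have "\<bar>(\<Sum>k=2..N+1. (f (g k) - f (g (k - 1))) * \<sigma> (w * (x - g k)))
          + f a * \<sigma> (w * (x - g 0)) - f x\<bar> < \<epsilon>" if x: "x \<in> {a..b}" for x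
  proof -
    obtain j where j: "1 \<le> j" "j \<le> N + 1" "g j \<le> x" "x < g (j + 1)"
      using grid_point_bracket[OF assms(3) N0 x] unfolding g_def by blast
    define D where "D k = f (g k) - f (g (k - 1))" for k
    define s where "s k = \<sigma> (w * (x - g k))" for k
    \<comment> \<open>Error of the step replacement: \<delta> away from x, while at the two
      neighbours of x only |\<sigma>| \<le> M is available, against a step value of 0 or 1.\<close>
    define E where "E k = \<delta> + (M + 1) * (of_bool (k = j) + of_bool (k = j + 1))" for k
    have s_E: "\<bar>s k - of_bool (k \<le> j)\<bar> \<le> E k" for k
    proof -
      consider "k < j" | "k = j \<or> k = j + 1" | "k > j + 1" by linarith
      then show ?thesis
      proof cases
        case 1
        then have "x - g k \<ge> h" using g_diff[of k j] j(3) by simp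
        then show ?thesis using w(2) 1 by (simp add: s_def E_def)
      next
        case 2
        then show ?thesis
          using M[of "w * (x - g k)"] \<delta>0 by (auto simp: s_def E_def abs_if split: if_splits)
      next
        case 3
        then have "x - g k \<le> -h" using g_diff[of "j + 1" k] j(4) by simp
        then show ?thesis using w(3) 3 by (simp add: s_def E_def)
      qed
    qed
    have D: "\<bar>D k\<bar> \<le> \<eta>" if "k \<in> {2..N+1}" for k
    proof -
      have "g k - g (k - 1) = h" using that by (simp add: g of_nat_diff algebra_simps)
      then have "\<bar>g k - g (k - 1)\<bar> < d" using h by simp
      then show ?thesis
        unfolding D_def using that by (intro less_imp_le[OF d(2)] gI) auto
    qed
    have "\<bar>\<Sum>k=2..N+1. D k * (s k - of_bool (k \<le> j))\<bar> \<le> (\<Sum>k=2..N+1. \<eta> * E k)"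
      using \<eta>(1)
      by (intro order_trans[OF sum_abs] sum_mono) (simp only: abs_mult mult_mono[OF D s_E] less_imp_le abs_ge_zero)
    also have "\<dots> = \<eta> * (N * \<delta> + (M + 1) *
        ((\<Sum>k=2..N+1. of_bool (k = j)) + (\<Sum>k=2..N+1. of_bool (k = j + 1))))"
      by (simp only: E_def sum.distrib flip: sum_distrib_left) simp
    \<comment> \<open>Each indicator sum is at most 1; it is 0 when its index leaves the range, as
      for j = 1 or j = N + 1 respectively.\<close>
    also have "\<dots> \<le> \<eta> * (1 + (M + 1) * (1 + 1))"
      using \<eta>(1) M0 N\<delta>
      by (intro mult_left_mono add_mono) (auto simp: of_bool_def sum.delta)
    finally have 1: "\<bar>\<Sum>k=2..N+1. D k * (s k - of_bool (k \<le> j))\<bar> \<le> \<eta> * (2 * M + 3)"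
      by (simp add: algebra_simps)
    \<comment> \<open>The extra point \<open>g 0\<close> = a - h is at distance at least h from all
      of [a,b], including x = a.\<close>
    have "\<bar>s 0 - 1\<bar> \<le> \<delta>"
      using w(2)[of "x - g 0"] x by (simp add: s_def g)
    then have "\<bar>f a * (s 0 - 1)\<bar> \<le> \<bar>f a\<bar> * \<delta>"
      unfolding abs_mult by (intro mult_left_mono) auto
    then have 2: "\<bar>f a * (s 0 - 1)\<bar> \<le> \<eta>" using fa\<delta> by linarith
    have "\<bar>g j - x\<bar> < d" using j(3,4) h(2) by (simp add: g algebra_simps)
    then have 3: "\<bar>f (g j) - f x\<bar> < \<eta>" using d(2) gI[OF j(1,2)] x by blast
    \<comment> \<open>Here \<open>g 1\<close> = a, and j \<le> N + 1 removes the cap.\<close>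
    have "(\<Sum>k=2..N+1. D k * of_bool (k \<le> j)) = f (g j) - f a"
      using sum_diff_step[OF j(1), of "\<lambda>k. f (g k)" N] j(2) by (simp add: D_def g)
    then have "(\<Sum>k=2..N+1. D k * s k) + f a * s 0 - f x
        = (\<Sum>k=2..N+1. D k * (s k - of_bool (k \<le> j))) + f a * (s 0 - 1) + (f (g j) - f x)"
      by (simp add: right_diff_distrib sum_subtractf)
    then have "\<bar>(\<Sum>k=2..N+1. D k * s k) + f a * s 0 - f x\<bar> < \<eta> * (2 * M + 3) + \<eta> + \<eta>"
      using 1 2 3 by linarith
    also have "\<dots> = \<epsilon>" using \<eta>(2) by (simp add: algebra_simps)
    finally show ?thesis by (simp only: D_def s_def)
  qed
  then show ?thesis
    using N0 w(1) unfolding g_def by blast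
qed

end
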